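(* Let $G=(V,E)$ be a directed acyclic graph and let $X,Y,Z\subseteq V$ be pairwise disjoint sets of nodes. Then $Z$ satisfies the constructive back-door criterion (CBC) relative to $(X,Y)$ in $G$ if and only if $Z$ satisfies the adjustment criterion (AC) relative to $(X,Y)$ in $G$.
   Context: Paths are node sequences without repetition in which consecutive nodes are adjacent (edges may be traversed in either direction). A path from a node of $X$ to a node of $Y$ is proper if only its start node is in $X$. It is causal if it is directed, $V_1\to\cdots\to V_k$; otherwise it is non-causal. Every node is its own ancestor and descendant; $An(S)$, $De(S)$ are the sets of ancestors and descendants of nodes of $S$. A node on a path is a collider if two arrowheads of the path meet at it. A path is $d$-connecting given $Z$ (not blocked by $Z$) if every collider on it is in $An(Z)$ and every non-collider on it is not in $Z$; otherwise it is blocked by $Z$. $Z$ $d$-separates $X$ and $Y$ if all paths between nodes of $X$ and nodes of $Y$ are blocked by $Z$. $G_{\overline{X}}$ is $G$ with all edges entering $X$ removed; $G_{\underline{X}}$ is $G$ with all edges leaving $X$ removed. $De_{\overline{X}}$ and $An_{\underline{X}}$ denote descendants in $G_{\overline{X}}$ and ancestors in $G_{\underline{X}}$. Adjustment criterion (AC): $Z$ satisfies the AC relative to $(X,Y)$ in $G$ if (a) no element of $Z$ is a descendant in $G_{\overline{X}}$ of any $W\in V\setminus X$ which lies on a proper causal path from $X$ to $Y$, and (b) all proper non-causal paths in $G$ from $X$ to $Y$ are blocked by $Z$. Let $PCP(X,Y)=(De_{\overline{X}}(X)\setminus X)\cap An_{\underline{X}}(Y)$ and $Dpcp(X,Y)=De(PCP(X,Y))$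 (descendants in $G$). The proper back-door graph $G^{pbd}_{XY}$ is obtained from $G$ by removing the first edge of every proper causal path from $X$ to $Y$, i.e. by removing all edges from a node of $X$ to a node of $PCP(X,Y)$. Constructive back-door criterion (CBC): $Z$ satisfies the CBC relative to $(X,Y)$ in $G$ if (a) $Z\subseteq V\setminus Dpcp(X,Y)$, and (b) $Z$ $d$-separates $X$ and $Y$ in $G^{pbd}_{XY}$. *)

theory Defs
  imports "Graph_Theory.Pair_Digraph" "Graph_Theory.Vertex_Walk" "Graph_Theory.Digraph_Component"
begin

section \<open>Directed acyclic graphs and their paths\<close>

text \<open>Neither nodes nor edges are required to be finite in number.\<close>

definition dag :: "'a pair_pre_digraph \<Rightarrow> bool" where
  "dag G \<longleftrightarrow> pair_wf_digraph G \<and> acyclic (parcs G)"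

text \<open>Without multi-arcs and 2-cycles a path is determined by its nodes, so paths
  traversing edges in either direction are vertex paths of the symmetric closure.\<close>

definition is_path :: "'a pair_pre_digraph \<Rightarrow> 'a list \<Rightarrow> bool" where
  "is_path G p \<longleftrightarrow> vpath p (mk_symmetric G)"

definition path_between :: "'a pair_pre_digraph \<Rightarrow> 'a set \<Rightarrow> 'a set \<Rightarrow> 'a list \<Rightarrow> bool" where
  "path_between G X Y p \<longleftrightarrow> is_path G p \<and> hd p \<in> X \<and> last p \<in> Y"

definition proper_path :: "'a pair_pre_digraph \<Rightarrow> 'a set \<Rightarrow> 'a set \<Rightarrow> 'a list \<Rightarrow> bool" where
  "proper_path G X Y p \<longleftrightarrow> path_between G X Y p \<and> set (tl p) \<inter> X = {}"

definition causal :: "'a pair_pre_digraph \<Rightarrow> 'a list \<Rightarrow> bool" where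
  "causal G p \<longleftrightarrow> vpath p G"

definition An :: "'a pair_pre_digraph \<Rightarrow> 'a set \<Rightarrow> 'a set" where
  "An G S = {v. \<exists>s\<in>S. v \<rightarrow>\<^sup>*\<^bsub>G\<^esub> s}"

definition De :: "'a pair_pre_digraph \<Rightarrow> 'a set \<Rightarrow> 'a set" where
  "De G S = {v. \<exists>s\<in>S. s \<rightarrow>\<^sup>*\<^bsub>G\<^esub> v}"

section \<open>d-separation\<close>

definition collider_at :: "'a pair_pre_digraph \<Rightarrow> 'a list \<Rightarrow> nat \<Rightarrow> bool" where
  "collider_at G p i \<longleftrightarrow> 0 < i \<and> Suc i < length p \<and>
     (p ! (i - 1), p ! i) \<in> parcs G \<and> (p ! Suc i, p ! i) \<in> parcs G"

text \<open>The end nodes of a path count as non-colliders.\<close>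

definition d_connecting :: "'a pair_pre_digraph \<Rightarrow> 'a set \<Rightarrow> 'a list \<Rightarrow> bool" where
  "d_connecting G Z p \<longleftrightarrow>
     (\<forall>i < length p. if collider_at G p i then p ! i \<in> An G Z else p ! i \<notin> Z)"

abbreviation blocked :: "'a pair_pre_digraph \<Rightarrow> 'a set \<Rightarrow> 'a list \<Rightarrow> bool" where
  "blocked G Z p \<equiv> \<not> d_connecting G Z p"

definition d_separates :: "'a pair_pre_digraph \<Rightarrow> 'a set \<Rightarrow> 'a set \<Rightarrow> 'a set \<Rightarrow> bool" where
  "d_separates G Z X Y \<longleftrightarrow> (\<forall>p. path_between G X Y p \<longrightarrow> blocked G Z p)"

section \<open>Adjustment criterion\<close>

text \<open>The graphs written $G_{\overline{X}}$ and $G_{\underline{X}}$.\<close>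

definition del_entering :: "'a pair_pre_digraph \<Rightarrow> 'a set \<Rightarrow> 'a pair_pre_digraph" where
  "del_entering G X = G\<lparr>parcs := {(u, v) \<in> parcs G. v \<notin> X}\<rparr>"

definition del_leaving :: "'a pair_pre_digraph \<Rightarrow> 'a set \<Rightarrow> 'a pair_pre_digraph" where
  "del_leaving G X = G\<lparr>parcs := {(u, v) \<in> parcs G. u \<notin> X}\<rparr>"

definition adjustment_criterion ::
    "'a pair_pre_digraph \<Rightarrow> 'a set \<Rightarrow> 'a set \<Rightarrow> 'a set \<Rightarrow> bool" where
  "adjustment_criterion G X Y Z \<longleftrightarrow>
     (\<forall>W \<in> pverts G - X. (\<exists>p. proper_path G X Y p \<and> causal G p \<and> W \<in> set p) \<longrightarrow>
        Z \<inter> De (del_entering G X) {W} = {}) \<and>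
     (\<forall>p. proper_path G X Y p \<and> \<not> causal G p \<longrightarrow> blocked G Z p)"

section \<open>Constructive back-door criterion\<close>

definition PCP :: "'a pair_pre_digraph \<Rightarrow> 'a set \<Rightarrow> 'a set \<Rightarrow> 'a set" where
  "PCP G X Y = (De (del_entering G X) X - X) \<inter> An (del_leaving G X) Y"

definition Dpcp :: "'a pair_pre_digraph \<Rightarrow> 'a set \<Rightarrow> 'a set \<Rightarrow> 'a set" where
  "Dpcp G X Y = De G (PCP G X Y)"

definition pcp_first_edges :: "'a pair_pre_digraph \<Rightarrow> 'a set \<Rightarrow> 'a set \<Rightarrow> 'a rel" where
  "pcp_first_edges G X Y =
     {(u, v). \<exists>q. proper_path G X Y (u # v # q) \<and> causal G (u # v # q)}"

definition proper_backdoor_graph ::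
    "'a pair_pre_digraph \<Rightarrow> 'a set \<Rightarrow> 'a set \<Rightarrow> 'a pair_pre_digraph" where
  "proper_backdoor_graph G X Y = G\<lparr>parcs := parcs G - pcp_first_edges G X Y\<rparr>"

definition constructive_backdoor_criterion ::
    "'a pair_pre_digraph \<Rightarrow> 'a set \<Rightarrow> 'a set \<Rightarrow> 'a set \<Rightarrow> bool" where
  "constructive_backdoor_criterion G X Y Z \<longleftrightarrow>
     Z \<subseteq> pverts G - Dpcp G X Y \<and> d_separates (proper_backdoor_graph G X Y) Z X Y"

text \<open>The removed edges are exactly those from \<open>X\<close> to \<open>PCP G X Y\<close>.\<close>

lemma wf_del_leaving:
  assumes "dag G"
  shows "wf_digraph (del_leaving G X)"
  using assms
  by (auto simp: dag_def del_leaving_def wf_digraph_def pair_wf_digraph_def)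

lemma vwalk_del_leaving:
  "vwalk p (del_leaving G X) \<longleftrightarrow> vwalk p G \<and> set (butlast p) \<inter> X = {}"
proof (induction p rule: vwalk_arcs.induct)
  case (3 x y xs)
  then show ?case by (auto simp: vwalk_def del_leaving_def)
qed (auto simp: vwalk_def del_leaving_def)

lemma causal_imp_is_path: "causal G p \<Longrightarrow> is_path G p"
  by (force simp: causal_def is_path_def vpath_def vwalk_def parcs_mk_symmetric)

lemma pcp_first_edges_eq:
  assumes "dag G" and "X \<inter> Y = {}"
  shows "pcp_first_edges G X Y = {(u, v) \<in> parcs G. u \<in> X \<and> v \<in> PCP G X Y}"
proof (intro set_eqI iffI; clarify)
  fix u v
  assume "(u, v) \<in> pcp_first_edges G X Y"
  then obtain q where pr: "proper_path G X Y (u # v # q)" and c: "causal G (u # v # q)"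
    by (auto simp: pcp_first_edges_def)
  from c have e: "(u, v) \<in> parcs G" and vG: "v \<in> pverts G"
    and uG: "u \<in> pverts G" and w: "vwalk (v # q) G"
    by (auto simp: causal_def vpath_def vwalk_def)
  from pr have u: "u \<in> X" and nX: "set (v # q) \<inter> X = {}" and l: "last (v # q) \<in> Y"
    by (auto simp: proper_path_def path_between_def split: if_splits)
  have "set (butlast (v # q)) \<inter> X = {}"
    using nX by (meson disjoint_iff in_set_butlastD)
  with w have "vwalk (v # q) (del_leaving G X)" by (simp only: vwalk_del_leaving)
  then have "reachable (del_leaving G X) v (last (v # q))"
    using wf_digraph.reachable_vwalk_conv[OF wf_del_leaving[OF assms(1)]] by (metis list.sel(1))
  with l have "v \<in> An (del_leaving G X) Y"
    by (auto simp: An_def)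
  moreover have "(u, v) \<in> rtrancl_on (pverts G) (parcs (del_entering G X))"
    using e nX vG u uG
    by (intro rtrancl_on_into_rtrancl_on[OF rtrancl_on_refl]) (auto simp: del_entering_def)
  then have "v \<in> De (del_entering G X) X"
    using u by (auto simp: De_def reachable_def del_entering_def)
  ultimately show "(u, v) \<in> parcs G \<and> u \<in> X \<and> v \<in> PCP G X Y"
    using e u nX by (auto simp: PCP_def)
next
  fix u v
  assume e: "(u, v) \<in> parcs G" and u: "u \<in> X" and v: "v \<in> PCP G X Y"
  from v obtain y where y: "y \<in> Y" "reachable (del_leaving G X) v y" and "v \<notin> X"
    by (auto simp: PCP_def An_def)
  from y(2) obtain p where
    p: "vpath p (del_leaving G X)" "hd p = v" "last p = y"
    using wf_digraph.reachable_vpath_conv[OF wf_del_leaving[OF assms(1)]] by metis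
  from p(1) have d: "distinct p" and w: "vwalk p G" and b: "set (butlast p) \<inter> X = {}"
    unfolding vpath_def vwalk_del_leaving by blast+
  from w have ne: "p \<noteq> []" by (simp add: vwalk_def)
  from e assms(1) have uG: "u \<in> pverts G"
    by (auto simp: dag_def dest: pair_wf_digraph.in_arcsD1)
  have "set p = insert (last p) (set (butlast p))"
    using ne by (metis append_butlast_last_id list.simps(15) rotate1.simps(2) set_rotate1)
  with b p(3) y(1) assms(2) have nX: "set p \<inter> X = {}" by auto
  from ne p(2) obtain q where q: "p = v # q" by (cases p) auto
  have "vwalk (u # p) G" using w e uG p(2) by (intro vwalk_consI) auto
  with d u nX have c: "causal G (u # v # q)" unfolding q causal_def vpath_def by auto
  have "proper_path G X Y (u # v # q)"
    using causal_imp_is_path[OF c] u nX y(1) p(3) q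
    by (auto simp: proper_path_def path_between_def)
  with c show "(u, v) \<in> pcp_first_edges G X Y" by (auto simp: pcp_first_edges_def)
qed

lemma parcs_proper_backdoor_graph:
  assumes "dag G" and "X \<inter> Y = {}"
  shows "parcs (proper_backdoor_graph G X Y) = parcs G - X \<times> PCP G X Y"
  by (auto simp: proper_backdoor_graph_def pcp_first_edges_eq[OF assms])

end

theory Submission
  imports Defs
begin

text \<open>
  A path that avoids the edges from \<open>X\<close> to \<open>PCP\<close> has the same colliders in \<open>G\<close> and in the proper
  back-door graph, and if \<open>Z\<close> avoids \<open>Dpcp\<close> then no directed path into \<open>Z\<close> uses a removed edge, so
  \<open>An Z\<close> is also the same in both graphs. A proper path from \<open>X\<close> to \<open>Y\<close> that does use a removed edge
  starts with it; if it is non-causal, its first collider lies in \<open>Dpcp\<close>, hence outside \<open>An Z\<close>, and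
  the path is blocked.

  For condition (a), the two criteria differ only if some \<open>z \<in> Z\<close> is reached from some \<open>w \<in> PCP\<close>
  only by directed paths that meet \<open>X\<close>. If \<open>x\<close> is the first node in \<open>X\<close> on such a path, then
  \<open>x \<leftarrow> \<dots> \<leftarrow> w \<rightarrow> \<dots> \<rightarrow> y\<close> contains a proper non-causal path from \<open>X\<close> to \<open>Y\<close> without colliders
  whose nodes other than \<open>x\<close> are descendants of \<open>w\<close> in the graph with the edges into \<open>X\<close> removed,
  so it contains no node of \<open>Z\<close> and is open.
\<close>

section \<open>Walks in a DAG\<close>

lemma vwalk_iff_successively:
  "vwalk p (with_proj G) \<longleftrightarrow>
     p \<noteq> [] \<and> set p \<subseteq> pverts G \<and> successively (\<lambda>u v. (u, v) \<in> parcs G) p"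
  by (induction p rule: vwalk_arcs.induct) (auto simp: vwalk_def)

lemma is_path_iff:
  "is_path G p \<longleftrightarrow> p \<noteq> [] \<and> distinct p \<and> set p \<subseteq> pverts G \<and>
     successively (\<lambda>u v. (u, v) \<in> parcs G \<or> (v, u) \<in> parcs G) p"
proof -
  have "(u, v) \<in> parcs (mk_symmetric G) \<longleftrightarrow> (u, v) \<in> parcs G \<or> (v, u) \<in> parcs G" for u v
    by (simp add: parcs_mk_symmetric Bex_def) blast
  moreover have "pverts (mk_symmetric G) = pverts G"
    by (simp add: mk_symmetric_def)
  ultimately show ?thesis
    by (auto simp: is_path_def vpath_def vwalk_iff_successively)
qed

lemma dag_asym: "dag G \<Longrightarrow> (u, v) \<in> parcs G \<Longrightarrow> (v, u) \<notin> parcs G"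
  unfolding dag_def acyclic_def by (blast intro: trancl_into_trancl)

text \<open>Passing to the transitive closure makes the walk sorted, so a repeated node would lie on
  a cycle.\<close>

lemma vwalk_imp_distinct:
  assumes "dag G" "vwalk p (with_proj G)"
  shows "distinct p"
proof -
  have "successively (\<lambda>u v. (u, v) \<in> (parcs G)\<^sup>+) p"
    using assms(2) unfolding vwalk_iff_successively
    by (blast intro: successively_mono)
  then have "sorted_wrt (\<lambda>u v. (u, v) \<in> (parcs G)\<^sup>+) p"
    by (subst (asm) successively_conv_sorted_wrt) (auto intro: transpI)
  then show ?thesis
    using assms(1) unfolding dag_def acyclic_def by (induction p) auto
qed

lemma causal_iff_vwalk: "dag G \<Longrightarrow> causal G p \<longleftrightarrow> vwalk p (with_proj G)"
  by (auto simp: causal_def vpath_def vwalk_imp_distinct)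

lemma vwalk_del_entering:
  "vwalk p (del_entering G X) \<longleftrightarrow> vwalk p G \<and> set (tl p) \<inter> X = {}"
proof (induction p rule: vwalk_arcs.induct)
  case (3 x y xs)
  then show ?case by (auto simp: vwalk_def del_entering_def)
qed (auto simp: vwalk_def del_entering_def)

lemma vwalk_del_leaving_disjoint:
  assumes "vwalk q (del_leaving G X)" "last q \<notin> X"
  shows "set q \<inter> X = {}"
  using assms unfolding vwalk_del_leaving
  by (cases q rule: rev_cases) auto

lemma dag_imp_wf_digraph: "dag G \<Longrightarrow> wf_digraph (with_proj G)"
  by (auto simp: dag_def wf_digraph_def pair_wf_digraph_def)

lemma vwalk_split:
  assumes "vwalk (a @ w # b) (with_proj G)"
  shows "vwalk (a @ [w]) (with_proj G)" and "vwalk (w # b) (with_proj G)"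
  using assms by (auto simp: vwalk_iff_successively successively_append_iff successively_Cons)

lemma vwalk_imp_reachable:
  assumes "dag G" "vwalk p (with_proj G)"
  shows "reachable G (hd p) (last p)"
  using wf_digraph.reachable_vwalk_conv[OF dag_imp_wf_digraph[OF assms(1)]] assms(2) by blast

lemma reachable_imp_vwalk:
  assumes "dag G" "reachable G u v"
  obtains p where "vwalk p (with_proj G)" "hd p = u" "last p = v"
  using wf_digraph.reachable_vwalk_conv[OF dag_imp_wf_digraph[OF assms(1)]] assms(2) by blast

lemma dag_del_entering: "dag G \<Longrightarrow> dag (del_entering G X)"
  by (auto simp: dag_def del_entering_def pair_wf_digraph_def intro: acyclic_subset)

lemma dag_del_leaving: "dag G \<Longrightarrow> dag (del_leaving G X)"
  by (auto simp: dag_def del_leaving_def pair_wf_digraph_def intro: acyclic_subset)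

lemma dag_proper_backdoor_graph: "dag G \<Longrightarrow> dag (proper_backdoor_graph G X Y)"
  by (auto simp: dag_def proper_backdoor_graph_def pair_wf_digraph_def intro: acyclic_subset)

text \<open>Splitting a proper causal path at \<open>w\<close> gives the two reachability
  conditions. Conversely, the two walks can be glued at \<open>w\<close> because acyclicity makes
  every directed walk a path. This links \<open>Dpcp\<close> to condition (a) of the adjustment
  criterion.\<close>

lemma PCP_iff:
  assumes "dag G" "X \<inter> Y = {}"
  shows "w \<in> PCP G X Y \<longleftrightarrow>
    w \<notin> X \<and> (\<exists>p. proper_path G X Y p \<and> causal G p \<and> w \<in> set p)"
proof
  assume "w \<in> PCP G X Y"
  then obtain x y where w: "w \<notin> X" and x: "x \<in> X" "reachable (del_entering G X) x w"
    and y: "y \<in> Y" "reachable (del_leaving G X) w y"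
    by (auto simp: PCP_def De_def An_def)
  obtain p where p: "vwalk p (del_entering G X)" "hd p = x" "last p = w"
    using reachable_imp_vwalk[OF dag_del_entering[OF assms(1)] x(2)] .
  obtain q where q: "vwalk q (del_leaving G X)" "hd q = w" "last q = y"
    using reachable_imp_vwalk[OF dag_del_leaving[OF assms(1)] y(2)] .
  have "p \<noteq> []" "q \<noteq> []" using p(1) q(1) by (auto simp: vwalk_def)
  then obtain p' q' where pq: "p = p' @ [w]" "q = w # q'"
    using p(3) q(2) by (metis append_butlast_last_id list.collapse)
  have "vwalk (p' @ [w]) G" "vwalk (w # q') G"
    using p(1) q(1) by (simp_all only: pq vwalk_del_entering vwalk_del_leaving)
  then have "vwalk (p' @ w # q') G"
    unfolding vwalk_iff_successively by (auto simp: successively_append_iff successively_Cons)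
  then have c: "causal G (p' @ w # q')" using assms(1) by (simp add: causal_iff_vwalk)
  have "p' \<noteq> []" using p(2) x(1) w pq by auto
  moreover have "set q \<inter> X = {}"
    using q(3) y(1) assms(2) by (intro vwalk_del_leaving_disjoint[OF q(1)]) auto
  ultimately have "proper_path G X Y (p' @ w # q')"
    using c p(1,2) q(3) x(1) y(1) unfolding vwalk_del_entering pq
    by (auto simp: proper_path_def path_between_def causal_imp_is_path)
  with c w show "w \<notin> X \<and> (\<exists>p. proper_path G X Y p \<and> causal G p \<and> w \<in> set p)"
    by force
next
  assume "w \<notin> X \<and> (\<exists>p. proper_path G X Y p \<and> causal G p \<and> w \<in> set p)"
  then obtain a b where w: "w \<notin> X" and pr: "proper_path G X Y (a @ w # b)"
    and "causal G (a @ w # b)"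
    by (metis in_set_conv_decomp)
  then have "vwalk (a @ w # b) G" using assms(1) by (simp add: causal_iff_vwalk)
  note W = vwalk_split[OF this]
  have "a \<noteq> []" "hd a \<in> X" "set (tl a) \<inter> X = {}" "set (w # b) \<inter> X = {}" "last (w # b) \<in> Y"
    using pr w by (cases a; auto simp: proper_path_def path_between_def)+
  then have "vwalk (a @ [w]) (del_entering G X)" "vwalk (w # b) (del_leaving G X)"
    using W w unfolding vwalk_del_entering vwalk_del_leaving
    by (auto dest: in_set_butlastD split: if_splits)
  from this[THEN vwalk_imp_reachable[rotated]] show "w \<in> PCP G X Y"
    using \<open>a \<noteq> []\<close> \<open>hd a \<in> X\<close> \<open>last (w # b) \<in> Y\<close> w dag_del_entering[OF assms(1)]
      dag_del_leaving[OF assms(1)]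
    by (auto simp: PCP_def De_def An_def split: if_splits)
qed

section \<open>Paths in subgraphs\<close>

lemma is_path_mono:
  "is_path H p \<Longrightarrow> pverts H = pverts G \<Longrightarrow> parcs H \<subseteq> parcs G \<Longrightarrow> is_path G p"
  unfolding is_path_iff by (auto intro: successively_mono)

text \<open>Consecutive nodes of \<open>p\<close> are joined by an edge of \<open>H\<close>, and
  acyclicity excludes the reverse edge in \<open>G\<close>, so \<open>G\<close> and \<open>H\<close>
  orient every step of \<open>p\<close> alike.\<close>

lemma collider_at_subgraph:
  assumes "dag G" "parcs H \<subseteq> parcs G" "is_path H p"
  shows "collider_at H p i \<longleftrightarrow> collider_at G p i"
proof
  assume G: "collider_at G p i"
  then obtain j where i: "i = Suc j" by (auto simp: collider_at_def gr0_conv_Suc)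
  have "\<forall>k. Suc k < length p \<longrightarrow> (p ! k, p ! Suc k) \<in> parcs H \<or> (p ! Suc k, p ! k) \<in> parcs H"
    using assms(3) by (simp add: is_path_iff successively_conv_nth)
  from this[rule_format, of i] this[rule_format, of j] show "collider_at H p i"
    using G assms(2) dag_asym[OF assms(1)] unfolding i collider_at_def by auto
qed (use assms(2) in \<open>auto simp: collider_at_def\<close>)

lemma An_mono:
  assumes "pverts H = pverts G" "parcs H \<subseteq> parcs G"
  shows "An H S \<subseteq> An G S"
  using rtrancl_on_mono[OF assms(2)] assms(1) by (fastforce simp: An_def reachable_def)

text \<open>Cut \<open>p\<close> at its last node in \<open>X\<close>. This reduces separation to
  proper paths.\<close>

lemma proper_suffix:
  assumes "path_between G X Y p" "d_connecting G Z p" "X \<inter> Z = {}"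
  obtains q where "proper_path G X Y q" "d_connecting G Z q"
proof -
  have "p \<noteq> []" "hd p \<in> X" using assms(1) by (auto simp: path_between_def is_path_iff)
  then have "\<exists>x\<in>set p. x \<in> X" by force
  then obtain a x b where p: "p = a @ x # b" "x \<in> X" "\<forall>v\<in>set b. v \<notin> X"
    using split_list_last_prop[of p "\<lambda>v. v \<in> X"] by blast
  have "proper_path G X Y (x # b)"
    using assms(1) p
    by (auto simp: proper_path_def path_between_def is_path_iff successively_append_iff)
  moreover have "d_connecting G Z (x # b)"
    unfolding d_connecting_def
  proof (intro allI impI)
    fix i assume i: "i < length (x # b)"
    show "if collider_at G (x # b) i then (x # b) ! i \<in> An G Z else (x # b) ! i \<notin> Z"
    proof (cases i)
      case 0
      \<comment> \<open>The cut node may have been a collider on \<open>p\<close>. As an end node it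
        is a non-collider, so it has to be outside \<open>Z\<close>.\<close>
      then show ?thesis using p(2) assms(3) by (auto simp: collider_at_def)
    next
      case (Suc j)
      have "collider_at G (x # b) i \<longleftrightarrow> collider_at G p (length a + i)"
        unfolding Suc by (auto simp: collider_at_def p(1) nth_append)
      moreover have "(x # b) ! i = p ! (length a + i)" by (simp add: p(1) nth_append)
      moreover have "length a + i < length p" using i by (simp add: p(1))
      ultimately show ?thesis using assms(2) unfolding d_connecting_def by metis
    qed
  qed
  ultimately show thesis using that by blast
qed

text \<open>The first edge traversed backwards is preceded by forward edges only, so it meets the
  last of these in a collider.\<close>

lemma first_collider:
  assumes "is_path G p" "Suc 0 < length p" "(p ! 0, p ! 1) \<in> parcs G" "\<not> causal G p"
  obtains i where "collider_at G p i" "(p ! 1, p ! i) \<in> (parcs G)\<^sup>*"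
proof -
  let ?bad = "\<lambda>j. Suc j < length p \<and> (p ! j, p ! Suc j) \<notin> parcs G"
  have "\<exists>j. ?bad j"
    using assms(1,4)
    by (auto simp: causal_def vpath_def vwalk_iff_successively is_path_iff successively_conv_nth)
  then obtain j where j: "?bad j" and min: "\<And>k. k < j \<Longrightarrow> \<not> ?bad k"
    using exists_least_iff[of ?bad] by blast
  have fwd: "(p ! k, p ! Suc k) \<in> parcs G" if "k < j" for k
    using min[OF that] j that by auto
  \<comment> \<open>The first edge points forward, so node \<open>j\<close> has a predecessor on
    \<open>p\<close>.\<close>
  have "0 < j" using j assms(3) by (cases j) auto
  have "(p ! Suc j, p ! j) \<in> parcs G"
    using assms(1) j by (auto simp: is_path_iff successively_conv_nth)
  then have "collider_at G p j"
    using \<open>0 < j\<close> j fwd[of "j - 1"] by (auto simp: collider_at_def)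
  moreover have "Suc k \<le> j \<Longrightarrow> (p ! 1, p ! Suc k) \<in> (parcs G)\<^sup>*" for k
  proof (induction k)
    case (Suc k)
    then show ?case using fwd[of "Suc k"] by (auto intro: rtrancl_into_rtrancl)
  qed simp
  then have "(p ! 1, p ! j) \<in> (parcs G)\<^sup>*" using \<open>0 < j\<close> by (metis Suc_pred' le_refl)
  ultimately show thesis using that by blast
qed

text \<open>All edges point away from \<open>c\<close>, so each inner node is the tail of an edge of
  the path: the one to its predecessor up to \<open>c\<close>, the one to its successor from
  \<open>c\<close> on.\<close>

lemma fork_not_collider:
  assumes "dag G" "vwalk (c # e) (with_proj G)" "vwalk (c # b) (with_proj G)"
  shows "\<not> collider_at G (rev e @ c # b) i"
proof
  assume col: "collider_at G (rev e @ c # b) i"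
  let ?p = "rev e @ c # b"
  show False
  proof (cases "i \<le> length e")
    case True
    have "successively (\<lambda>u v. (v, u) \<in> parcs G) (rev (c # e))"
      using assms(2) unfolding vwalk_iff_successively successively_rev by simp
    then have "(rev (c # e) ! i, rev (c # e) ! (i - 1)) \<in> parcs G"
      using True col by (auto simp: successively_conv_nth collider_at_def gr0_conv_Suc)
    moreover have "rev (c # e) ! k = ?p ! k" if "k \<le> length e" for k
      using that by (auto simp: nth_append)
    ultimately have "(?p ! i, ?p ! (i - 1)) \<in> parcs G" using True by simp
    then show False using col dag_asym[OF assms(1)] by (auto simp: collider_at_def)
  next
    case False
    then obtain k where k: "i = length e + k" using le_Suc_ex nat_le_linear by blast
    have "Suc k < length (c # b)" using col by (auto simp: k collider_at_def)
    then have "((c # b) ! k, (c # b) ! Suc k) \<in> parcs G"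
      using assms(3) unfolding vwalk_iff_successively successively_conv_nth by blast
    then have "(?p ! i, ?p ! Suc i) \<in> parcs G" by (simp add: k nth_append)
    then show False using col dag_asym[OF assms(1)] by (auto simp: collider_at_def)
  qed
qed

section \<open>Equivalence of the criteria\<close>

text \<open>Removed edges enter \<open>PCP\<close>. A directed walk into \<open>Z\<close> through
  one of them would put its end into \<open>Dpcp\<close>.\<close>

lemma An_proper_backdoor_graph:
  assumes "dag G" "X \<inter> Y = {}" "Z \<inter> Dpcp G X Y = {}"
  shows "An (proper_backdoor_graph G X Y) Z = An G Z"
proof
  let ?H = "proper_backdoor_graph G X Y"
  have V: "pverts ?H = pverts G" by (simp add: proper_backdoor_graph_def)
  show "An ?H Z \<subseteq> An G Z"
    by (rule An_mono) (auto simp: proper_backdoor_graph_def)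
  show "An G Z \<subseteq> An ?H Z"
  proof
    fix v assume "v \<in> An G Z"
    then obtain z where z: "z \<in> Z" and "(v, z) \<in> rtrancl_on (pverts G) (parcs G)"
      by (auto simp: An_def reachable_def)
    from this(2) have "(v, z) \<in> rtrancl_on (pverts G) (parcs ?H)"
    proof (induction rule: converse_rtrancl_on_induct)
      case (step u w)
      have "w \<notin> PCP G X Y"
        using step(2) z assms(3) by (auto simp: Dpcp_def De_def reachable_def)
      then show ?case
        using step by (auto simp: parcs_proper_backdoor_graph[OF assms(1,2)]
            intro: converse_rtrancl_on_into_rtrancl_on)
    qed auto
    then show "v \<in> An ?H Z" using z by (auto simp: An_def reachable_def V)
  qed
qed

text \<open>An open proper path of the back-door graph is open in \<open>G\<close> too, hence causal
  by condition (b). But then its first edge was removed.\<close>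

lemma adjustment_imp_backdoor_separation:
  assumes "dag G" "X \<inter> Y = {}" "X \<inter> Z = {}" "adjustment_criterion G X Y Z"
  shows "d_separates (proper_backdoor_graph G X Y) Z X Y"
  unfolding d_separates_def
proof (intro allI impI notI)
  let ?H = "proper_backdoor_graph G X Y"
  fix p assume "path_between ?H X Y p" "d_connecting ?H Z p"
  then obtain q where q: "proper_path ?H X Y q" "d_connecting ?H Z q"
    using proper_suffix[OF _ _ assms(3)] by metis
  have sub: "parcs ?H \<subseteq> parcs G" and V: "pverts ?H = pverts G"
    by (auto simp: proper_backdoor_graph_def)
  have qH: "is_path ?H q" using q(1) by (auto simp: proper_path_def path_between_def)
  have qG: "proper_path G X Y q"
    using q(1) is_path_mono[OF qH V sub] by (auto simp: proper_path_def path_between_def)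
  have "d_connecting G Z q"
    using q(2) An_mono[OF V sub]
    unfolding d_connecting_def collider_at_subgraph[OF assms(1) sub qH] by (meson in_mono)
  with qG have c: "causal G q"
    using assms(4) by (auto simp: adjustment_criterion_def)
  have "hd q \<in> X" "last q \<in> Y" "q \<noteq> []"
    using qG by (auto simp: proper_path_def path_between_def is_path_iff)
  then obtain u v r where uvr: "q = u # v # r"
    using assms(2) by (metis disjoint_iff last.simps list.exhaust list.sel(1))
  have "(u, v) \<in> pcp_first_edges G X Y"
    using qG c unfolding uvr by (auto simp: pcp_first_edges_def)
  moreover have "(u, v) \<in> parcs G"
    using c unfolding uvr causal_def vpath_def vwalk_iff_successively by simp
  moreover have "(u, v) \<in> parcs ?H \<or> (v, u) \<in> parcs ?H"
    using qH unfolding uvr is_path_iff by simp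
  ultimately show False
    using sub dag_asym[OF assms(1)] by (auto simp: proper_backdoor_graph_def)
qed

lemma adjustment_imp_disjoint_Dpcp:
  assumes "dag G" "X \<inter> Y = {}" "X \<inter> Z = {}" "adjustment_criterion G X Y Z"
  shows "Z \<inter> Dpcp G X Y = {}"
proof (rule ccontr)
  assume "Z \<inter> Dpcp G X Y \<noteq> {}"
  then obtain z w where z: "z \<in> Z" and w: "w \<in> PCP G X Y" and r: "reachable G w z"
    by (auto simp: Dpcp_def De_def)
  have wX: "w \<notin> X" using w by (simp add: PCP_def)
  obtain p where p: "vwalk p (with_proj G)" "hd p = w" "last p = z"
    using reachable_imp_vwalk[OF assms(1) r] .
  have "w \<in> pverts G" using p by (auto simp: vwalk_iff_successively)
  then have free: "Z \<inter> De (del_entering G X) {w} = {}"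
    using assms(4) w wX PCP_iff[OF assms(1,2)] unfolding adjustment_criterion_def by blast
  \<comment> \<open>On a walk from \<open>w\<close> that avoids \<open>X\<close>, every node is a
    descendant of \<open>w\<close> in \<open>del_entering G X\<close>, so condition (a) keeps it out
    of \<open>Z\<close>.\<close>
  have clear: "set q \<inter> Z = {}" if q: "vwalk q (with_proj G)" "hd q = w" "set q \<inter> X = {}" for q
  proof -
    have "v \<notin> Z" if v: "v \<in> set q" for v
    proof -
      obtain a b where ab: "q = a @ v # b" using v by (meson split_list)
      have "vwalk (a @ [v]) (del_entering G X)"
        unfolding vwalk_del_entering using q(3) vwalk_split(1)[of a v b G] q(1)
        by (cases a) (auto simp: ab)
      from vwalk_imp_reachable[OF dag_del_entering[OF assms(1)] this]
      have "v \<in> De (del_entering G X) {w}" using q(2) by (cases a) (auto simp: ab De_def)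
      then show ?thesis using free by auto
    qed
    then show ?thesis by auto
  qed
  have "\<exists>x\<in>set p. x \<in> X"
    using clear[OF p(1,2)] p(1,3) z by (force simp: vwalk_def)
  then obtain a x s where px: "p = a @ x # s" "x \<in> X" "\<forall>v\<in>set a. v \<notin> X"
    using split_list_first_prop[of p "\<lambda>v. v \<in> X"] by blast
  have a: "a \<noteq> []" "hd a = w" using px p(2) wX by (cases a; auto)+
  have ax: "vwalk (a @ [x]) (with_proj G)" using vwalk_split(1) p(1) px(1) by metis
  then have "vwalk a (with_proj G)"
    using a by (auto simp: vwalk_iff_successively successively_append_iff)
  then have aZ: "set a \<inter> Z = {}" using a px(3) by (intro clear) auto
  obtain y where y: "y \<in> Y" "reachable (del_leaving G X) w y"
    using w by (auto simp: PCP_def An_def)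
  obtain q where q: "vwalk q (del_leaving G X)" "hd q = w" "last q = y"
    using reachable_imp_vwalk[OF dag_del_leaving[OF assms(1)] y(2)] .
  have qG: "vwalk q (with_proj G)" and "q \<noteq> []"
    using q(1) unfolding vwalk_del_leaving by (auto simp: vwalk_def)
  have qX: "set q \<inter> X = {}"
    using q(3) y(1) assms(2) by (intro vwalk_del_leaving_disjoint[OF q(1)]) auto
  have qZ: "set q \<inter> Z = {}" using clear qG q(2) qX by blast
  have "\<exists>c\<in>set q. c \<in> set a" using a q(2) \<open>q \<noteq> []\<close> by (metis hd_in_set)
  \<comment> \<open>Branching at the last node of \<open>q\<close> on \<open>a\<close> turns the walk \<open>x \<leftarrow> \<dots> \<leftarrow> w \<rightarrow> \<dots> \<rightarrow> y\<close> into a path.\<close>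
  then obtain d c b where qc: "q = d @ c # b" "c \<in> set a" "\<forall>v\<in>set b. v \<notin> set a"
    using split_list_last_prop[of q "\<lambda>v. v \<in> set a"] by blast
  obtain f g where ac: "a = f @ c # g" using qc(2) by (meson split_list)
  let ?e = "g @ [x]" let ?t = "rev ?e @ c # b"
  have we: "vwalk (c # ?e) (with_proj G)" using vwalk_split(2)[of f c ?e G] ax by (simp add: ac)
  have wb: "vwalk (c # b) (with_proj G)" using vwalk_split(2) qG qc(1) by metis
  have "distinct (c # ?e)" "distinct (c # b)"
    using vwalk_imp_distinct[OF assms(1)] we wb by blast+
  \<comment> \<open>The nodes of \<open>g\<close> lie on \<open>a\<close>, which \<open>b\<close>
    avoids by the choice of \<open>c\<close>, and \<open>x\<close> is not on
    \<open>q\<close>.\<close>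
  then have "distinct ?t" using qc qX px(2) by (auto simp: ac)
  moreover have "successively (\<lambda>u v. (u, v) \<in> parcs G \<or> (v, u) \<in> parcs G) ?t"
  proof -
    let ?A = "\<lambda>u v. (u, v) \<in> parcs G \<or> (v, u) \<in> parcs G"
    have "successively ?A (c # ?e)" "successively ?A (c # b)"
      using we wb unfolding vwalk_iff_successively by (blast intro: successively_mono)+
    moreover have "successively ?A (rev (c # ?e)) = successively ?A (c # ?e)"
      unfolding successively_rev by (simp only: disj_commute)
    ultimately have "successively ?A (rev ?e @ [c])" "successively ?A (c # b)"
      by simp_all
    then show ?thesis
      unfolding successively_append_iff[of _ "rev ?e"] by simp
  qed
  ultimately have "is_path G ?t"
    using we wb by (auto simp: is_path_iff vwalk_iff_successively)
  then have "proper_path G X Y ?t"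
    using px q(3) y(1) qX by (auto simp: proper_path_def path_between_def ac qc(1) split: if_splits)
  moreover have "\<not> causal G ?t"
  proof
    assume "causal G ?t"
    \<comment> \<open>The neighbour of \<open>x\<close> on \<open>?t\<close> is the last node of
      \<open>g\<close>, or \<open>c\<close> if \<open>g\<close> is empty. The edge between them
      enters \<open>x\<close>.\<close>
    then have "(x, hd (rev g @ c # b)) \<in> parcs G"
      unfolding causal_def vpath_def vwalk_iff_successively
      by (cases g rule: rev_cases) auto
    moreover have "(hd (rev g @ c # b), x) \<in> parcs G"
      using we unfolding vwalk_iff_successively
      by (cases g rule: rev_cases) (auto simp: successively_append_iff successively_Cons)
    ultimately show False using dag_asym[OF assms(1)] by blast
  qed
  moreover have "set ?t \<inter> Z = {}"
    using aZ qZ px(2) assms(3) by (auto simp: ac qc(1))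
  then have "d_connecting G Z ?t"
    unfolding d_connecting_def using fork_not_collider[OF assms(1) we wb]
    by (meson disjoint_iff nth_mem)
  ultimately show False using assms(4) by (auto simp: adjustment_criterion_def)
qed

lemma constructive_backdoor_imp_adjustment:
  assumes "dag G" "X \<inter> Y = {}" "constructive_backdoor_criterion G X Y Z"
  shows "adjustment_criterion G X Y Z"
  unfolding adjustment_criterion_def
proof (intro conjI ballI allI impI notI)
  let ?H = "proper_backdoor_graph G X Y"
  have Z: "Z \<inter> Dpcp G X Y = {}" and sep: "d_separates ?H Z X Y"
    using assms(3) by (auto simp: constructive_backdoor_criterion_def)
  have sub: "parcs ?H \<subseteq> parcs G" and V: "pverts ?H = pverts G"
    by (auto simp: proper_backdoor_graph_def)
  show "Z \<inter> De (del_entering G X) {W} = {}"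
    if "W \<in> pverts G - X" "\<exists>p. proper_path G X Y p \<and> causal G p \<and> W \<in> set p" for W
  proof -
    have W: "W \<in> PCP G X Y" using that PCP_iff[OF assms(1,2)] by blast
    have sub': "parcs (del_entering G X) \<subseteq> parcs G" by (auto simp: del_entering_def)
    have "De (del_entering G X) {W} \<subseteq> Dpcp G X Y"
      using W rtrancl_on_mono[OF sub' order_refl]
      by (fastforce simp: Dpcp_def De_def reachable_def del_entering_def)
    with Z show ?thesis by auto
  qed
  show False if "proper_path G X Y p \<and> \<not> causal G p" "d_connecting G Z p" for p
  \<comment> \<open>If \<open>p\<close> survives in the back-door graph, it is open there as well.
    Otherwise it uses a removed edge.\<close>
  proof (cases "is_path ?H p")
    case True
    have "path_between ?H X Y p"
      using that(1) True by (auto simp: proper_path_def path_between_def)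
    moreover have "d_connecting ?H Z p"
      using that(2) unfolding d_connecting_def collider_at_subgraph[OF assms(1) sub True]
        An_proper_backdoor_graph[OF assms(1,2) Z] .
    ultimately show False using sep by (auto simp: d_separates_def)
  next
    case False
    have p: "is_path G p" "set (tl p) \<inter> X = {}"
      using that(1) by (auto simp: proper_path_def path_between_def)
    have tlX: "p ! Suc k \<notin> X" if "Suc k < length p" for k
      using p(2) that by (cases p) (auto dest: nth_mem)
    obtain i where i: "Suc i < length p" and
      "\<not> ((p ! i, p ! Suc i) \<in> parcs ?H \<or> (p ! Suc i, p ! i) \<in> parcs ?H)"
      using False p(1) V by (auto simp: is_path_iff successively_conv_nth)
    moreover have "(p ! i, p ! Suc i) \<in> parcs G \<or> (p ! Suc i, p ! i) \<in> parcs G"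
      using p(1) i by (auto simp: is_path_iff successively_conv_nth)
    \<comment> \<open>Removed edges have their tail in \<open>X\<close>, and a proper path meets
      \<open>X\<close> only at its start. So the missing edge is traversed forwards and is the first
      one.\<close>
    ultimately have e: "(p ! i, p ! Suc i) \<in> parcs G" "p ! i \<in> X" "p ! Suc i \<in> PCP G X Y"
      using tlX[OF i] by (auto simp: parcs_proper_backdoor_graph[OF assms(1,2)])
    have "i = 0" using e(2) tlX[of "i - 1"] i by (cases i) auto
    have "(p ! 0, p ! 1) \<in> parcs G" "Suc 0 < length p" "\<not> causal G p"
      using i e(1) that(1) \<open>i = 0\<close> by auto
    then obtain j where j: "collider_at G p j" "(p ! 1, p ! j) \<in> (parcs G)\<^sup>*"
      using first_collider[OF p(1)] by blast
    \<comment> \<open>The open collider leads on to some \<open>z\<close> in \<open>Z\<close>, which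
      is thus a descendant of \<open>p ! 1\<close> in \<open>PCP\<close>.\<close>
    then have "p ! j \<in> An G Z" "p ! j \<in> pverts G" "p ! 1 \<in> pverts G"
      using that(2) p(1) i \<open>i = 0\<close>
      by (auto simp: d_connecting_def collider_at_def is_path_iff subset_iff)
    then obtain z where "z \<in> Z" "reachable G (p ! j) z" by (auto simp: An_def)
    moreover have "reachable G (p ! 1) (p ! j)"
      using j(2) wf_digraph.reachable_conv[OF dag_imp_wf_digraph[OF assms(1)]]
        \<open>p ! j \<in> pverts G\<close> \<open>p ! 1 \<in> pverts G\<close> by simp
    ultimately have "z \<in> Dpcp G X Y"
      using e(3) \<open>i = 0\<close> by (auto simp: Dpcp_def De_def reachable_def intro: rtrancl_on_trans)
    with \<open>z \<in> Z\<close> Z show False by auto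
  qed
qed

theorem theorem1:
  fixes G :: "'a pair_pre_digraph" and X Y Z :: "'a set"
  assumes "dag G"
    and "X \<subseteq> pverts G" and "Y \<subseteq> pverts G" and "Z \<subseteq> pverts G"
    and "X \<inter> Y = {}" and "X \<inter> Z = {}" and "Y \<inter> Z = {}"
  shows "constructive_backdoor_criterion G X Y Z \<longleftrightarrow> adjustment_criterion G X Y Z"
proof
  assume "adjustment_criterion G X Y Z"
  then have "Z \<inter> Dpcp G X Y = {}" "d_separates (proper_backdoor_graph G X Y) Z X Y"
    using adjustment_imp_disjoint_Dpcp adjustment_imp_backdoor_separation assms by metis+
  then show "constructive_backdoor_criterion G X Y Z"
    using assms(4) by (auto simp: constructive_backdoor_criterion_def)
qed (use constructive_backdoor_imp_adjustment assms in metis)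

end
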